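(* A fully-typed relational to RDF data exchange setting $\mathcal{E} = (\mathbf{R}, \mathbf{S}, \Sigma_{\mathrm{st}}, \mathcal{F}, F_{\mathrm{int}})$ is consistent (that is, every valid source instance of $\mathbf{R}$ admits a solution w.r.t. $\mathcal{E}$) if and only if it is key-covered.
   Context: **Domain.** $\mathbf{Dom}$ is a fixed infinite enumerable set partitioned into three infinite sets $\mathbf{Dom} = \mathbf{Iri}\cup\mathbf{Lit}\cup\mathbf{Blank}$ (IRIs, literals, blank nodes). $\mathbf{NullLit}\subseteq\mathbf{Lit}$ is an infinite subset of null literals. **Source schema.** A relational schema is $\mathbf{R}=(\mathcal{R},\Sigma_{\mathrm{fd}})$ where $\mathcal{R}$ is a finite set of relation symbols with arities and $\Sigma_{\mathrm{fd}}$ is a set of functional dependencies $R:X\to Y$, with $R\in\mathcal{R}$ of arity $n$ and $X,Y\subseteq\{1,\dots,n\}$, meaning $\forall \mathbf{x},\mathbf{y}.\ R(\mathbf{x})\wedge R(\mathbf{y})\wedge\bigwedge_{i\in X}x_i=y_i\Rightarrow\bigwedge_{j\in Y}x_j=y_j$. An instance $I$ of $\mathbf{R}$ assigns to each $R\in\mathcal R$ of arity $n$ a relation $R^I\subseteq\mathbf{Dom}^n$; only instances all of whose values are in $\mathbf{Lit}\setminus\mathbf{NullLit}$ are considered. $I$ is valid if $I\models\Sigma_{\mathrm{fd}}$. **Target schema.** A ShEx schema is $\mathbf{S}=(\mathcal{T},\delta)$ where $\mathcal{T}$ is a finite set of shape names (types) and $\delta$ maps each $T\in\mathcal{T}$ to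 a finite set of triple constraints $p::S^\mu$ with $p\in\mathbf{Iri}$, $S\in\mathcal{T}\cup\{\mathit{Lit}\}$ ($\mathit{Lit}$ a reserved symbol), $\mu\in\{1,?,*,+\}$, such that for each $T$ and $p$, $\delta(T)$ contains at most one triple constraint using $p$. **Typed graphs.** An RDF graph is a set of triples in $(\mathbf{Iri}\cup\mathbf{Blank})\times\mathbf{Iri}\times(\mathbf{Iri}\cup\mathbf{Blank}\cup\mathbf{Lit})$; its nodes are the elements occurring in first or third position of a triple. A $\mathcal{T}$-typed graph is a pair $(G,\mathit{typing})$ with $G$ an RDF graph and $\mathit{typing}$ a map from nodes of $G$ to subsets of $\mathcal{T}\cup\{\mathit{Lit}\}$. It is viewed as the relational structure over $\mathcal{G}_{\mathcal T}=\{\mathit{Triple}\}\cup\mathcal{T}\cup\{\mathit{Lit}\}$ ($\mathit{Triple}$ ternary, the others unary) with facts $\mathit{Triple}(s,p,o)$ for $(s,p,o)\in G$ and $T(n)$ for $n$ a node and $T\in\mathit{typing}(n)$. **Dependencies of the schema.** $\Sigma_{\mathbf{S}}$ consists, for each $T\in\mathcal{T}$ and each $p::S^\mu\in\delta(T)$, of: - $\forall x,y.\ T(x)\wedge\mathit{Triple}(x,p,y)\Rightarrow S(y)$; - if $\mu\in\{1,+\}$: $\forall x.\ T(x)\Rightarrow\exists y.\,\mathit{Triple}(x,p,y)$; - if $\mu\in\{1,?\}$: $\forall x,y,z.\ T(x)\wedge\mathit{Triple}(x,p,y)\wedge\mathit{Triple}(x,p,z)\Rightarrow y=z$. **Data exchange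 setting.** $\mathcal{E}=(\mathbf{R},\mathbf{S},\Sigma_{\mathrm{st}},\mathcal{F},F_{\mathrm{int}})$ where $\mathbf{R}=(\mathcal{R},\Sigma_{\mathrm{fd}})$ is a relational schema, $\mathbf{S}=(\mathcal{T},\delta)$ is a ShEx schema, $\mathcal{F}$ is a finite set of function symbols (IRI constructors) with arities, $F_{\mathrm{int}}$ interprets each $f\in\mathcal{F}$ of arity $n$ as a function $\mathbf{Dom}^n\to\mathbf{Iri}$, and $\Sigma_{\mathrm{st}}$ is a set of source-to-target tuple generating dependencies (st-tgds) $\forall\mathbf{x}.\ \varphi\Rightarrow\psi$, with $\varphi$ a conjunction of atomic formulas over $\mathcal{R}$ and $\psi$ a conjunction of atomic formulas over $\mathcal{G}_{\mathcal T}\cup\mathcal{F}$ (function terms are not nested). The interpretations of distinct function symbols have disjoint ranges. **Solution.** For a valid instance $I$ of $\mathbf{R}$, a solution for $I$ w.r.t. $\mathcal{E}$ is any $\mathcal{T}$-typed graph $J$ with $I\cup J\cup F_{\mathrm{int}}\models\Sigma_{\mathrm{st}}$ and $J\models\Sigma_{\mathbf{S}}$. **Fully-typed.** $\mathcal{E}$ is fully-typed if every st-tgd has the form $\forall\mathbf{x}.\ \varphi\Rightarrow\mathit{Triple}(s,p,o)\wedge T_s(s)\wedge T_o(o)$ where: $p\in\mathbf{Iri}$; $s=f(\mathbf{y})$ with $f\in\mathcal{F}$, $\mathbf{y}\subseteq\mathbf{x}$, and $T_s\in\mathcal{T}$; either $o=g(\mathbf{z})$ with $g\in\mathcal{F}$,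 $\mathbf{z}\subseteq\mathbf{x}$, and $T_o\in\mathcal{T}$, or $o=z$ is a variable of $\mathbf{x}$ and $T_o=\mathit{Lit}$; moreover $p::T_o^\mu\in\delta(T_s)$ for some multiplicity $\mu$; and every $f\in\mathcal{F}$ is used with a unique type in $\mathcal{T}$. **Key-covered.** Let $\mathcal{E}$ be fully-typed. Two (not necessarily distinct) st-tgds are contentious if both use the same $f\in\mathcal{F}$ for their subjects and have the same predicate $p$ (hence the same subject type $T_s$ and object type $T_o$), and $p::T_o^\mu\in\delta(T_s)$ with $\mu\in\{1,?\}$. Write two contentious st-tgds, with pairwise disjoint variables, as $\sigma_i=\forall\mathbf{x}_i,\mathbf{y}_i.\ \varphi_i(\mathbf{x}_i,\mathbf{y}_i)\Rightarrow\mathit{Triple}(f(\mathbf{x}_i),p,o_i)\wedge T_s(f(\mathbf{x}_i))\wedge T_o(o_i)$, $i=1,2$ (for a st-tgd paired with itself, take two renamed copies). They are functionally overlapping if for every valid instance $I$ of $\mathbf{R}$, $I\cup F_{\mathrm{int}}\models\forall\mathbf{x}_1,\mathbf{y}_1,\mathbf{x}_2,\mathbf{y}_2.\ \varphi_1(\mathbf{x}_1,\mathbf{y}_1)\wedge\varphi_2(\mathbf{x}_2,\mathbf{y}_2)\wedge\mathbf{x}_1=\mathbf{x}_2\Rightarrow o_1=o_2$. $\mathcal{E}$ is key-covered if every pair of its contentious st-tgds is functionally overlapping.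
   Formalization: Each IRI constructor is additionally assumed injective on tuples of values from Lit \ NullLit; without this, a constant constructor gives a fully-typed, key-covered setting that is not consistent. *)

theory Defs
  imports Main "HOL-Library.Countable"
begin

(* The fixed domain Dom is the whole type 'd. Nothing is assumed about how many literals
   lie outside null_lits. *)
class rdf_domain = countable +
  fixes iris :: "'a set"
    and lits :: "'a set"
    and blanks :: "'a set"
    and null_lits :: "'a set"
  assumes dom_cover: "iris \<union> lits \<union> blanks = UNIV"
    and dom_disjoint: "iris \<inter> lits = {}" "iris \<inter> blanks = {}" "lits \<inter> blanks = {}"
    and dom_infinite: "infinite iris" "infinite lits" "infinite blanks"
    and null_lits_subset: "null_lits \<subseteq> lits"
    and null_lits_infinite: "infinite null_lits"


section \<open>Relational source schemas\<close>

(* The triple (R, X, Y) stands for R : X -> Y. Positions are numbered from 0, as list indices. *)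
record 'r rel_schema =
  rels :: "'r set"
  rel_arity :: "'r \<Rightarrow> nat"
  fds :: "('r \<times> nat set \<times> nat set) set"

definition rel_schema_ok :: "'r rel_schema \<Rightarrow> bool" where
  "rel_schema_ok \<R> \<longleftrightarrow>
     finite (rels \<R>) \<and>
     (\<forall>(R, X, Y) \<in> fds \<R>. R \<in> rels \<R> \<and> X \<subseteq> {..<rel_arity \<R> R} \<and> Y \<subseteq> {..<rel_arity \<R> R})"

type_synonym ('r, 'd) rel_instance = "'r \<Rightarrow> 'd list set"

definition is_instance :: "'r rel_schema \<Rightarrow> ('r, 'd::rdf_domain) rel_instance \<Rightarrow> bool" where
  "is_instance \<R> I \<longleftrightarrow>
     (\<forall>R \<in> rels \<R>. \<forall>t \<in> I R. length t = rel_arity \<R> R \<and> set t \<subseteq> lits - null_lits)"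

definition satisfies_fds :: "'r rel_schema \<Rightarrow> ('r, 'd) rel_instance \<Rightarrow> bool" where
  "satisfies_fds \<R> I \<longleftrightarrow>
     (\<forall>(R, X, Y) \<in> fds \<R>. \<forall>t \<in> I R. \<forall>u \<in> I R.
        (\<forall>i \<in> X. t ! i = u ! i) \<longrightarrow> (\<forall>j \<in> Y. t ! j = u ! j))"

definition valid_instance :: "'r rel_schema \<Rightarrow> ('r, 'd::rdf_domain) rel_instance \<Rightarrow> bool" where
  "valid_instance \<R> I \<longleftrightarrow> is_instance \<R> I \<and> satisfies_fds \<R> I"


section \<open>ShEx schemas and typed graphs\<close>

datatype mult = MultOne | MultOpt | MultStar | MultPlus

(* Elements of T + {Lit}; the reserved symbol is distinct from all shape names by construction. *)
datatype 't shape = Shape 't | LitShape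

(* (p, S, m) \<in> delta T is the triple constraint p :: S^m of T. *)
record ('d, 't) shex_schema =
  types :: "'t set"
  delta :: "'t \<Rightarrow> ('d \<times> 't shape \<times> mult) set"

definition shapes :: "('d, 't) shex_schema \<Rightarrow> 't shape set" where
  "shapes \<S> = insert LitShape (Shape ` types \<S>)"

definition shex_schema_ok :: "('d::rdf_domain, 't) shex_schema \<Rightarrow> bool" where
  "shex_schema_ok \<S> \<longleftrightarrow>
     finite (types \<S>) \<and>
     (\<forall>T \<in> types \<S>.
        finite (delta \<S> T) \<and>
        (\<forall>(p, S, m) \<in> delta \<S> T. p \<in> iris \<and> S \<in> shapes \<S>) \<and>
        (\<forall>p S m S' m'. (p, S, m) \<in> delta \<S> T \<and> (p, S', m') \<in> delta \<S> T \<longrightarrow> S = S' \<and> m = m'))"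

(* Values of typing outside the nodes of the graph are irrelevant: see shape_fact. *)
record ('d, 't) typed_graph =
  graph :: "('d \<times> 'd \<times> 'd) set"
  typing :: "'d \<Rightarrow> 't shape set"

definition nodes :: "('d, 't) typed_graph \<Rightarrow> 'd set" where
  "nodes J = {n. \<exists>p m. (n, p, m) \<in> graph J \<or> (m, p, n) \<in> graph J}"

definition typed_graph_ok :: "('d::rdf_domain, 't) shex_schema \<Rightarrow> ('d, 't) typed_graph \<Rightarrow> bool" where
  "typed_graph_ok \<S> J \<longleftrightarrow>
     graph J \<subseteq> (iris \<union> blanks) \<times> iris \<times> (iris \<union> blanks \<union> lits) \<and>
     (\<forall>n \<in> nodes J. typing J n \<subseteq> shapes \<S>)"

definition triple_fact :: "('d, 't) typed_graph \<Rightarrow> 'd \<Rightarrow> 'd \<Rightarrow> 'd \<Rightarrow> bool" where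
  "triple_fact J s p ob \<longleftrightarrow> (s, p, ob) \<in> graph J"

definition shape_fact :: "('d, 't) typed_graph \<Rightarrow> 't shape \<Rightarrow> 'd \<Rightarrow> bool" where
  "shape_fact J S n \<longleftrightarrow> n \<in> nodes J \<and> S \<in> typing J n"

definition satisfies_shex :: "('d, 't) shex_schema \<Rightarrow> ('d, 't) typed_graph \<Rightarrow> bool" where
  "satisfies_shex \<S> J \<longleftrightarrow>
     (\<forall>T \<in> types \<S>. \<forall>(p, S, m) \<in> delta \<S> T.
        (\<forall>x y. shape_fact J (Shape T) x \<and> triple_fact J x p y \<longrightarrow> shape_fact J S y) \<and>
        (m \<in> {MultOne, MultPlus} \<longrightarrow>
           (\<forall>x. shape_fact J (Shape T) x \<longrightarrow> (\<exists>y. triple_fact J x p y))) \<and>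
        (m \<in> {MultOne, MultOpt} \<longrightarrow>
           (\<forall>x y z. shape_fact J (Shape T) x \<and> triple_fact J x p y \<and> triple_fact J x p z \<longrightarrow> y = z)))"


section \<open>Source-to-target dependencies\<close>

datatype 'd sterm = Var nat | Const 'd

datatype ('d, 'f) hterm = Simple "'d sterm" | App 'f "'d sterm list"

datatype ('d, 'r) body_atom = RelAtom 'r "'d sterm list"

datatype ('d, 'f, 't) head_atom =
    TripleAtom "('d, 'f) hterm" "('d, 'f) hterm" "('d, 'f) hterm"
  | ShapeAtom "'t shape" "('d, 'f) hterm"

(* Conjunctions are lists of atoms. The universally quantified variables of an st-tgd are those
   occurring in its body. *)
datatype ('d, 'r, 'f, 't) st_tgd =
  StTgd (tgd_body: "('d, 'r) body_atom list") (tgd_head: "('d, 'f, 't) head_atom list")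

fun sterm_vars :: "'d sterm \<Rightarrow> nat set" where
  "sterm_vars (Var x) = {x}"
| "sterm_vars (Const c) = {}"

fun hterm_vars :: "('d, 'f) hterm \<Rightarrow> nat set" where
  "hterm_vars (Simple u) = sterm_vars u"
| "hterm_vars (App f us) = (\<Union>u \<in> set us. sterm_vars u)"

fun body_atom_vars :: "('d, 'r) body_atom \<Rightarrow> nat set" where
  "body_atom_vars (RelAtom R us) = (\<Union>u \<in> set us. sterm_vars u)"

fun head_atom_vars :: "('d, 'f, 't) head_atom \<Rightarrow> nat set" where
  "head_atom_vars (TripleAtom s p ob) = hterm_vars s \<union> hterm_vars p \<union> hterm_vars ob"
| "head_atom_vars (ShapeAtom S u) = hterm_vars u"

definition tgd_vars :: "('d, 'r, 'f, 't) st_tgd \<Rightarrow> nat set" where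
  "tgd_vars \<sigma> = (\<Union>a \<in> set (tgd_body \<sigma>). body_atom_vars a)"

fun head_atom_terms :: "('d, 'f, 't) head_atom \<Rightarrow> ('d, 'f) hterm set" where
  "head_atom_terms (TripleAtom s p ob) = {s, p, ob}"
| "head_atom_terms (ShapeAtom S u) = {u}"


section \<open>Data exchange settings\<close>

record ('d, 'r, 'f, 't) setting =
  rel_schema :: "'r rel_schema"
  shex_schema :: "('d, 't) shex_schema"
  st_tgds :: "('d, 'r, 'f, 't) st_tgd set"
  funs :: "'f set"
  fun_arity :: "'f \<Rightarrow> nat"
  fun_interp :: "'f \<Rightarrow> 'd list \<Rightarrow> 'd"

definition st_tgd_ok :: "('d, 'r, 'f, 't) setting \<Rightarrow> ('d, 'r, 'f, 't) st_tgd \<Rightarrow> bool" where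
  "st_tgd_ok E \<sigma> \<longleftrightarrow>
     (\<forall>R us. RelAtom R us \<in> set (tgd_body \<sigma>) \<longrightarrow>
        R \<in> rels (rel_schema E) \<and> length us = rel_arity (rel_schema E) R) \<and>
     (\<forall>S u. ShapeAtom S u \<in> set (tgd_head \<sigma>) \<longrightarrow> S \<in> shapes (shex_schema E)) \<and>
     (\<forall>a \<in> set (tgd_head \<sigma>). \<forall>f us. App f us \<in> head_atom_terms a \<longrightarrow>
        f \<in> funs E \<and> length us = fun_arity E f) \<and>
     (\<forall>a \<in> set (tgd_head \<sigma>). head_atom_vars a \<subseteq> tgd_vars \<sigma>)"

definition setting_ok :: "('d::rdf_domain, 'r, 'f, 't) setting \<Rightarrow> bool" where
  "setting_ok E \<longleftrightarrow>
     rel_schema_ok (rel_schema E) \<and>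
     shex_schema_ok (shex_schema E) \<and>
     finite (funs E) \<and>
     (\<forall>f \<in> funs E. \<forall>xs. length xs = fun_arity E f \<longrightarrow> fun_interp E f xs \<in> iris) \<and>
     (\<forall>f \<in> funs E. \<forall>g \<in> funs E. f \<noteq> g \<longrightarrow>
        fun_interp E f ` {xs. length xs = fun_arity E f} \<inter>
        fun_interp E g ` {xs. length xs = fun_arity E g} = {}) \<and>
     (\<forall>\<sigma> \<in> st_tgds E. st_tgd_ok E \<sigma>)"

(* IRI constructors build distinct IRIs from distinct tuples of source values.
   Without this, key-coverage, which compares the arguments x1 and x2 and not the
   IRIs f(x1) and f(x2), does not imply consistency: interpret a unary f by a constant function and
   take the st-tgd R(x, y) => Triple(f(x), p, y) /\ T(f(x)) /\ Lit(y), with the dependency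
   R : 1 -> 2 and p :: Lit^1 in delta T. Only the tuples that source instances can
   provide matter, so injectivity is required on these alone. *)
definition injective_constructors :: "('d::rdf_domain, 'r, 'f, 't) setting \<Rightarrow> bool" where
  "injective_constructors E \<longleftrightarrow>
     (\<forall>f \<in> funs E.
        inj_on (fun_interp E f) {xs. length xs = fun_arity E f \<and> set xs \<subseteq> lits - null_lits})"

fun eval_sterm :: "(nat \<Rightarrow> 'd) \<Rightarrow> 'd sterm \<Rightarrow> 'd" where
  "eval_sterm \<alpha> (Var x) = \<alpha> x"
| "eval_sterm \<alpha> (Const c) = c"

fun eval_hterm :: "('f \<Rightarrow> 'd list \<Rightarrow> 'd) \<Rightarrow> (nat \<Rightarrow> 'd) \<Rightarrow> ('d, 'f) hterm \<Rightarrow> 'd" where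
  "eval_hterm F \<alpha> (Simple u) = eval_sterm \<alpha> u"
| "eval_hterm F \<alpha> (App f us) = F f (map (eval_sterm \<alpha>) us)"

fun holds_body_atom :: "('r, 'd) rel_instance \<Rightarrow> (nat \<Rightarrow> 'd) \<Rightarrow> ('d, 'r) body_atom \<Rightarrow> bool" where
  "holds_body_atom I \<alpha> (RelAtom R us) \<longleftrightarrow> map (eval_sterm \<alpha>) us \<in> I R"

definition holds_body :: "('r, 'd) rel_instance \<Rightarrow> (nat \<Rightarrow> 'd) \<Rightarrow> ('d, 'r, 'f, 't) st_tgd \<Rightarrow> bool" where
  "holds_body I \<alpha> \<sigma> \<longleftrightarrow> (\<forall>a \<in> set (tgd_body \<sigma>). holds_body_atom I \<alpha> a)"

fun holds_head_atom ::
  "('d, 't) typed_graph \<Rightarrow> ('f \<Rightarrow> 'd list \<Rightarrow> 'd) \<Rightarrow> (nat \<Rightarrow> 'd) \<Rightarrow> ('d, 'f, 't) head_atom \<Rightarrow> bool" where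
  "holds_head_atom J F \<alpha> (TripleAtom s p ob) \<longleftrightarrow>
     triple_fact J (eval_hterm F \<alpha> s) (eval_hterm F \<alpha> p) (eval_hterm F \<alpha> ob)"
| "holds_head_atom J F \<alpha> (ShapeAtom S u) \<longleftrightarrow> shape_fact J S (eval_hterm F \<alpha> u)"

definition satisfies_st_tgd ::
  "('r, 'd) rel_instance \<Rightarrow> ('d, 't) typed_graph \<Rightarrow> ('f \<Rightarrow> 'd list \<Rightarrow> 'd) \<Rightarrow>
   ('d, 'r, 'f, 't) st_tgd \<Rightarrow> bool" where
  "satisfies_st_tgd I J F \<sigma> \<longleftrightarrow>
     (\<forall>\<alpha>. holds_body I \<alpha> \<sigma> \<longrightarrow> (\<forall>a \<in> set (tgd_head \<sigma>). holds_head_atom J F \<alpha> a))"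

definition solution ::
  "('d::rdf_domain, 'r, 'f, 't) setting \<Rightarrow> ('r, 'd) rel_instance \<Rightarrow> ('d, 't) typed_graph \<Rightarrow> bool" where
  "solution E I J \<longleftrightarrow>
     typed_graph_ok (shex_schema E) J \<and>
     (\<forall>\<sigma> \<in> st_tgds E. satisfies_st_tgd I J (fun_interp E) \<sigma>) \<and>
     satisfies_shex (shex_schema E) J"

definition consistent :: "('d::rdf_domain, 'r, 'f, 't) setting \<Rightarrow> bool" where
  "consistent E \<longleftrightarrow> (\<forall>I. valid_instance (rel_schema E) I \<longrightarrow> (\<exists>J. solution E I J))"


section \<open>Fully-typed and key-covered settings\<close>

(* \<sigma> = \<forall>x. \<phi> \<Rightarrow> Triple(f(ys), p, ob) \<and> Ts(f(ys)) \<and> To(ob) *)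
definition typed_form ::
  "('d, 'r, 'f, 't) st_tgd \<Rightarrow> 'f \<Rightarrow> nat list \<Rightarrow> 'd \<Rightarrow> ('d, 'f) hterm \<Rightarrow> 't \<Rightarrow> 't shape \<Rightarrow> bool" where
  "typed_form \<sigma> f ys p ob Ts To \<longleftrightarrow>
     tgd_head \<sigma> =
       [TripleAtom (App f (map Var ys)) (Simple (Const p)) ob,
        ShapeAtom (Shape Ts) (App f (map Var ys)),
        ShapeAtom To ob]"

definition fully_typed_tgd ::
  "('d::rdf_domain, 'r, 'f, 't) setting \<Rightarrow> ('d, 'r, 'f, 't) st_tgd \<Rightarrow> bool" where
  "fully_typed_tgd E \<sigma> \<longleftrightarrow>
     (\<exists>f ys p ob Ts To.
        typed_form \<sigma> f ys p ob Ts To \<and>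
        p \<in> iris \<and> f \<in> funs E \<and> set ys \<subseteq> tgd_vars \<sigma> \<and> Ts \<in> types (shex_schema E) \<and>
        ((\<exists>g zs T. ob = App g (map Var zs) \<and> g \<in> funs E \<and> set zs \<subseteq> tgd_vars \<sigma> \<and>
                    To = Shape T \<and> T \<in> types (shex_schema E)) \<or>
         (\<exists>z \<in> tgd_vars \<sigma>. ob = Simple (Var z) \<and> To = LitShape)) \<and>
        (\<exists>m. (p, To, m) \<in> delta (shex_schema E) Ts))"

definition used_with :: "('d, 'r, 'f, 't) setting \<Rightarrow> 'f \<Rightarrow> 't \<Rightarrow> bool" where
  "used_with E f T \<longleftrightarrow> (\<exists>\<sigma> \<in> st_tgds E. \<exists>us. ShapeAtom (Shape T) (App f us) \<in> set (tgd_head \<sigma>))"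

definition fully_typed :: "('d::rdf_domain, 'r, 'f, 't) setting \<Rightarrow> bool" where
  "fully_typed E \<longleftrightarrow>
     (\<forall>\<sigma> \<in> st_tgds E. fully_typed_tgd E \<sigma>) \<and>
     (\<forall>f \<in> funs E. \<forall>T T'. used_with E f T \<and> used_with E f T' \<longrightarrow> T = T')"

definition contentious ::
  "('d, 'r, 'f, 't) setting \<Rightarrow> ('d, 'r, 'f, 't) st_tgd \<Rightarrow> ('d, 'r, 'f, 't) st_tgd \<Rightarrow> bool" where
  "contentious E \<sigma>1 \<sigma>2 \<longleftrightarrow>
     (\<exists>f p Ts To xs1 xs2 o1 o2 m.
        typed_form \<sigma>1 f xs1 p o1 Ts To \<and> typed_form \<sigma>2 f xs2 p o2 Ts To \<and>
        (p, To, m) \<in> delta (shex_schema E) Ts \<and> m \<in> {MultOne, MultOpt})"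

(* Evaluating the two st-tgds under independent assignments \<alpha>1 and \<alpha>2 amounts to first renaming
   their variables apart, also when both are the same st-tgd. *)
definition functionally_overlapping ::
  "('d::rdf_domain, 'r, 'f, 't) setting \<Rightarrow>
   ('d, 'r, 'f, 't) st_tgd \<Rightarrow> ('d, 'r, 'f, 't) st_tgd \<Rightarrow> bool" where
  "functionally_overlapping E \<sigma>1 \<sigma>2 \<longleftrightarrow>
     (\<forall>f p Ts To xs1 xs2 o1 o2.
        typed_form \<sigma>1 f xs1 p o1 Ts To \<and> typed_form \<sigma>2 f xs2 p o2 Ts To \<longrightarrow>
        (\<forall>I. valid_instance (rel_schema E) I \<longrightarrow>
           (\<forall>\<alpha>1 \<alpha>2. holds_body I \<alpha>1 \<sigma>1 \<and> holds_body I \<alpha>2 \<sigma>2 \<and> map \<alpha>1 xs1 = map \<alpha>2 xs2 \<longrightarrow>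
              eval_hterm (fun_interp E) \<alpha>1 o1 = eval_hterm (fun_interp E) \<alpha>2 o2)))"

definition key_covered :: "('d::rdf_domain, 'r, 'f, 't) setting \<Rightarrow> bool" where
  "key_covered E \<longleftrightarrow>
     (\<forall>\<sigma>1 \<in> st_tgds E. \<forall>\<sigma>2 \<in> st_tgds E.
        contentious E \<sigma>1 \<sigma>2 \<longrightarrow> functionally_overlapping E \<sigma>1 \<sigma>2)"

end

(* If E is key-covered, the triples produced by the st-tgds already respect the functionality
   constraints: constructors are injective with disjoint ranges, so two triples with the same
   subject come from the same f and the same arguments. Missing mandatory successors are all
   supplied by one blank node that carries every shape and is its own p-successor for every p.
   Conversely, a solution for an instance in which a contentious pair disagrees would contain two
   distinct p-successors of one subject. *)
theory Submission
  imports Defs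
begin

section \<open>Parameters of a fully-typed dependency\<close>

text \<open>The head list displays every parameter, and \<open>ys\<close> is recovered because
  \<open>map Var\<close> is injective. Hence the parameters bound existentially in
  \<open>fully_typed_tgd\<close> and \<open>contentious\<close> can be identified with any that are
  already at hand.\<close>

lemma typed_form_inject:
  assumes "typed_form \<sigma> f ys p ob Ts To" "typed_form \<sigma> f' ys' p' ob' Ts' To'"
  shows "f' = f \<and> ys' = ys \<and> p' = p \<and> ob' = ob \<and> Ts' = Ts \<and> To' = To"
  using assms by (auto simp: typed_form_def inj_map_eq_map inj_def)

lemma typed_form_used_with:
  assumes "typed_form \<sigma> f ys p ob Ts To" "\<sigma> \<in> st_tgds E"
  shows "used_with E f Ts"
proof -
  have "ShapeAtom (Shape Ts) (App f (map Var ys)) \<in> set (tgd_head \<sigma>)"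
    using assms(1) by (simp add: typed_form_def)
  then show ?thesis using assms(2) unfolding used_with_def by blast
qed

lemma fully_typed_tgdE:
  assumes "fully_typed_tgd E \<sigma>" "typed_form \<sigma> f ys p ob Ts To"
  obtains m where "p \<in> iris" "f \<in> funs E" "set ys \<subseteq> tgd_vars \<sigma>" "Ts \<in> types (shex_schema E)"
    "(\<exists>g zs T. ob = App g (map Var zs) \<and> g \<in> funs E \<and> set zs \<subseteq> tgd_vars \<sigma> \<and>
        To = Shape T \<and> T \<in> types (shex_schema E)) \<or>
     (\<exists>z \<in> tgd_vars \<sigma>. ob = Simple (Var z) \<and> To = LitShape)"
    "(p, To, m) \<in> delta (shex_schema E) Ts"
proof -
  obtain f' ys' p' ob' Ts' To' m where *: "typed_form \<sigma> f' ys' p' ob' Ts' To'"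
    "p' \<in> iris" "f' \<in> funs E" "set ys' \<subseteq> tgd_vars \<sigma>" "Ts' \<in> types (shex_schema E)"
    "(\<exists>g zs T. ob' = App g (map Var zs) \<and> g \<in> funs E \<and> set zs \<subseteq> tgd_vars \<sigma> \<and>
        To' = Shape T \<and> T \<in> types (shex_schema E)) \<or>
     (\<exists>z \<in> tgd_vars \<sigma>. ob' = Simple (Var z) \<and> To' = LitShape)"
    "(p', To', m) \<in> delta (shex_schema E) Ts'"
    using assms(1) unfolding fully_typed_tgd_def by (elim exE conjE) blast
  from typed_form_inject[OF assms(2) *(1)] have
    "f' = f" "ys' = ys" "p' = p" "ob' = ob" "Ts' = Ts" "To' = To" by simp_all
  from *(2-)[unfolded this] show thesis by (rule that)
qed

lemma typed_form_holds_head: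
  assumes "typed_form \<sigma> f ys p ob Ts To"
  shows "(\<forall>a \<in> set (tgd_head \<sigma>). holds_head_atom J F \<alpha> a) \<longleftrightarrow>
    triple_fact J (F f (map \<alpha> ys)) p (eval_hterm F \<alpha> ob) \<and>
    shape_fact J (Shape Ts) (F f (map \<alpha> ys)) \<and> shape_fact J To (eval_hterm F \<alpha> ob)"
  using assms by (simp add: typed_form_def comp_def)

section \<open>Necessity of key coverage\<close>

lemma consistent_imp_key_covered:
  fixes E :: "('d::rdf_domain, 'r, 'f, 't) setting"
  assumes ft: "fully_typed E" and cons: "consistent E"
  shows "key_covered E"
  unfolding key_covered_def functionally_overlapping_def
proof (intro ballI impI allI, elim conjE)
  fix \<sigma>1 \<sigma>2 f p Ts To xs1 xs2 o1 o2 and I :: "('r, 'd) rel_instance" and \<alpha>1 \<alpha>2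
  assume \<sigma>: "\<sigma>1 \<in> st_tgds E" "\<sigma>2 \<in> st_tgds E" and "contentious E \<sigma>1 \<sigma>2"
    and form: "typed_form \<sigma>1 f xs1 p o1 Ts To" "typed_form \<sigma>2 f xs2 p o2 Ts To"
    and valid: "valid_instance (rel_schema E) I"
    and body: "holds_body I \<alpha>1 \<sigma>1" "holds_body I \<alpha>2 \<sigma>2" and eq: "map \<alpha>1 xs1 = map \<alpha>2 xs2"
  let ?F = "fun_interp E"
  \<comment> \<open>The parameters hidden in \<open>contentious\<close> are the fixed ones, so the
    multiplicity belongs to the constraint of \<open>Ts\<close> on this very
    \<open>p\<close>.\<close>
  obtain m where m: "(p, To, m) \<in> delta (shex_schema E) Ts" "m \<in> {MultOne, MultOpt}"
    using \<open>contentious E \<sigma>1 \<sigma>2\<close> typed_form_inject[OF form(1)] unfolding contentious_def by blast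
  have "fully_typed_tgd E \<sigma>1" using ft \<sigma>(1) by (simp add: fully_typed_def)
  then have Ts: "Ts \<in> types (shex_schema E)" using form(1) by (rule fully_typed_tgdE)
  obtain J where J: "solution E I J" using cons valid by (auto simp: consistent_def)
  then have head: "\<forall>a \<in> set (tgd_head \<sigma>1). holds_head_atom J ?F \<alpha>1 a"
    "\<forall>a \<in> set (tgd_head \<sigma>2). holds_head_atom J ?F \<alpha>2 a"
    using \<sigma> body by (auto simp: solution_def satisfies_st_tgd_def)
  note head = head(1)[unfolded typed_form_holds_head[OF form(1)]]
    head(2)[unfolded typed_form_holds_head[OF form(2)]]
  have "\<forall>x y z. shape_fact J (Shape Ts) x \<and> triple_fact J x p y \<and> triple_fact J x p z \<longrightarrow> y = z"
    using J Ts m unfolding solution_def satisfies_shex_def by fastforce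
  \<comment> \<open>Equal arguments give the same subject, so both objects are
    \<open>p\<close>-successors of one node of type \<open>Ts\<close>.\<close>
  then show "eval_hterm ?F \<alpha>1 o1 = eval_hterm ?F \<alpha>2 o2" using head eq by metis
qed

section \<open>The chase and its completion by one blank node\<close>

text \<open>Keeps the constructor and its arguments apart instead of the subject IRI they build,
  because key coverage compares arguments.\<close>

definition fires ::
  "('d, 'r, 'f, 't) setting \<Rightarrow> ('r, 'd) rel_instance \<Rightarrow> 'f \<Rightarrow> 'd list \<Rightarrow> 'd \<Rightarrow> 'd \<Rightarrow> 't \<Rightarrow> 't shape \<Rightarrow> bool"
where
  "fires E I f vs p v Ts To \<longleftrightarrow>
     (\<exists>\<sigma> \<in> st_tgds E. \<exists>\<alpha> ys ob. typed_form \<sigma> f ys p ob Ts To \<and> holds_body I \<alpha> \<sigma> \<and>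
        vs = map \<alpha> ys \<and> v = eval_hterm (fun_interp E) \<alpha> ob)"

definition chase_graph ::
  "('d, 'r, 'f, 't) setting \<Rightarrow> ('r, 'd) rel_instance \<Rightarrow> ('d \<times> 'd \<times> 'd) set" where
  "chase_graph E I = {(fun_interp E f vs, p, v) | f vs p v. \<exists>Ts To. fires E I f vs p v Ts To}"

definition chase_typing ::
  "('d, 'r, 'f, 't) setting \<Rightarrow> ('r, 'd) rel_instance \<Rightarrow> 'd \<Rightarrow> 't shape set" where
  "chase_typing E I n =
     {S. \<exists>f vs p v Ts To. fires E I f vs p v Ts To \<and>
        (n = fun_interp E f vs \<and> S = Shape Ts \<or> n = v \<and> S = To)}"

text \<open>An edge to \<open>b\<close> is added whatever the multiplicity of the constraint, which
  is harmless: it is added only where the chase has no \<open>p\<close>-successor and so becomes the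
  only one. The self-loops give \<open>b\<close> a successor for every constraint it inherits from
  carrying all shapes, and they make \<open>b\<close> a node even if the chase is empty.\<close>

definition completion ::
  "('d::rdf_domain, 'r, 'f, 't) setting \<Rightarrow> ('r, 'd) rel_instance \<Rightarrow> 'd \<Rightarrow> ('d, 't) typed_graph" where
  "completion E I b =
     \<lparr>graph = chase_graph E I
        \<union> {(x, p, b) | x p. (\<exists>T S m. Shape T \<in> chase_typing E I x \<and> T \<in> types (shex_schema E) \<and>
              (p, S, m) \<in> delta (shex_schema E) T) \<and>
              (\<nexists>y. (x, p, y) \<in> chase_graph E I)}
        \<union> {(b, p, b) | p. p \<in> iris},
      typing = (chase_typing E I)(b := shapes (shex_schema E))\<rparr>"

section \<open>Constructor terms over source values\<close>

text \<open>A body variable sits at some position of a source fact. This places constructor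
  arguments in the set on which \<open>injective_constructors\<close> gives injectivity, and makes
  variable objects literals.\<close>

lemma holds_body_vars:
  assumes "setting_ok E" "\<sigma> \<in> st_tgds E" "is_instance (rel_schema E) I" "holds_body I \<alpha> \<sigma>"
    and "x \<in> tgd_vars \<sigma>"
  shows "\<alpha> x \<in> lits - null_lits"
proof -
  obtain a where a: "a \<in> set (tgd_body \<sigma>)" "x \<in> body_atom_vars a"
    using assms(5) by (auto simp: tgd_vars_def)
  obtain R us where R: "a = RelAtom R us" by (cases a)
  have "R \<in> rels (rel_schema E)" using assms(1,2) a(1) R by (auto simp: setting_ok_def st_tgd_ok_def)
  moreover have "map (eval_sterm \<alpha>) us \<in> I R" using assms(4) a(1) R by (auto simp: holds_body_def)
  ultimately have *: "eval_sterm \<alpha> ` set us \<subseteq> lits - null_lits"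
    using assms(3) unfolding is_instance_def by fastforce
  obtain u where u: "u \<in> set us" "x \<in> sterm_vars u" using a(2) R by auto
  have "u = Var x" using u(2) by (cases u) auto
  with u(1) * show ?thesis by force
qed

definition source_term :: "('d::rdf_domain, 'r, 'f, 't) setting \<Rightarrow> 'f \<Rightarrow> 'd list \<Rightarrow> bool" where
  "source_term E f vs \<longleftrightarrow>
     f \<in> funs E \<and> length vs = fun_arity E f \<and> set vs \<subseteq> lits - null_lits"

lemma source_term_iris:
  "setting_ok E \<Longrightarrow> source_term E f vs \<Longrightarrow> fun_interp E f vs \<in> iris"
  by (simp add: setting_ok_def source_term_def)

text \<open>Disjoint ranges identify the constructors, then injectivity on source tuples identifies
  the arguments.\<close>

lemma source_term_inject:
  assumes "setting_ok E" "injective_constructors E" "source_term E f vs" "source_term E g ws"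
    and "fun_interp E f vs = fun_interp E g ws"
  shows "f = g \<and> vs = ws"
proof -
  have "f = g"
  proof (rule ccontr)
    assume "f \<noteq> g"
    then have "fun_interp E f ` {xs. length xs = fun_arity E f} \<inter>
        fun_interp E g ` {xs. length xs = fun_arity E g} = {}"
      using assms(1,3,4) by (simp add: setting_ok_def source_term_def)
    moreover have "fun_interp E f vs \<in> fun_interp E f ` {xs. length xs = fun_arity E f}"
      "fun_interp E g ws \<in> fun_interp E g ` {xs. length xs = fun_arity E g}"
      using assms(3,4) by (auto simp: source_term_def)
    ultimately show False using assms(5) by auto
  qed
  then show ?thesis
    using assms(2-5) by (auto simp: injective_constructors_def source_term_def dest: inj_onD)
qed

text \<open>Stated for a term anywhere in the head, so that it serves subjects and constructed
  objects alike.\<close>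

lemma source_term_map_Var:
  assumes "setting_ok E" "is_instance (rel_schema E) I" "\<sigma> \<in> st_tgds E" "holds_body I \<alpha> \<sigma>"
    and "a \<in> set (tgd_head \<sigma>)" "App f (map Var ys) \<in> head_atom_terms a"
  shows "source_term E f (map \<alpha> ys)"
proof -
  have "st_tgd_ok E \<sigma>" using assms(1,3) by (simp add: setting_ok_def)
  then have "f \<in> funs E" "length (map (Var :: nat \<Rightarrow> 'a sterm) ys) = fun_arity E f"
    "head_atom_vars a \<subseteq> tgd_vars \<sigma>"
    using assms(5,6) unfolding st_tgd_ok_def by blast+
  moreover have "set ys \<subseteq> head_atom_vars a" using assms(6) by (cases a) fastforce+
  ultimately show ?thesis
    using holds_body_vars[OF assms(1,3,2,4)] by (auto simp: source_term_def)
qed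

section \<open>Triples and shapes of the chase\<close>

locale chase =
  fixes E :: "('d::rdf_domain, 'r, 'f, 't) setting" and I :: "('r, 'd) rel_instance" and b :: 'd
  assumes ok: "setting_ok E"
    and inj: "injective_constructors E"
    and ft: "fully_typed E"
    and valid: "valid_instance (rel_schema E) I"
    and blank: "b \<in> blanks"
begin

abbreviation "F \<equiv> fun_interp E"
abbreviation "\<S> \<equiv> shex_schema E"

lemma fires_subject:
  assumes "fires E I f vs p v Ts To"
  shows "source_term E f vs" "used_with E f Ts" "p \<in> iris" "Ts \<in> types \<S>"
    "\<exists>m. (p, To, m) \<in> delta \<S> Ts"
proof -
  obtain \<sigma> \<alpha> ys ob where \<sigma>: "\<sigma> \<in> st_tgds E" and form: "typed_form \<sigma> f ys p ob Ts To"
    and body: "holds_body I \<alpha> \<sigma>" and v: "vs = map \<alpha> ys"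
    using assms unfolding fires_def by blast
  have i: "is_instance (rel_schema E) I" using valid by (simp add: valid_instance_def)
  show "source_term E f vs" unfolding v
    by (rule source_term_map_Var[OF ok i \<sigma> body,
          of "TripleAtom (App f (map Var ys)) (Simple (Const p)) ob"])
      (use form in \<open>auto simp: typed_form_def\<close>)
  show "used_with E f Ts" using form \<sigma> by (rule typed_form_used_with)
  have "fully_typed_tgd E \<sigma>" using ft \<sigma> by (simp add: fully_typed_def)
  then show "p \<in> iris" "Ts \<in> types \<S>" "\<exists>m. (p, To, m) \<in> delta \<S> Ts"
    using form by (auto elim: fully_typed_tgdE)
qed

lemma fires_object:
  assumes "fires E I f vs p v Ts To"
  shows "(\<exists>g ws T. v = F g ws \<and> source_term E g ws \<and> used_with E g T \<and> To = Shape T \<and> T \<in> types \<S>)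
    \<or> v \<in> lits \<and> To = LitShape"
proof -
  obtain \<sigma> \<alpha> ys ob where \<sigma>: "\<sigma> \<in> st_tgds E" and form: "typed_form \<sigma> f ys p ob Ts To"
    and body: "holds_body I \<alpha> \<sigma>" and v: "v = eval_hterm F \<alpha> ob"
    using assms unfolding fires_def by blast
  have i: "is_instance (rel_schema E) I" using valid by (simp add: valid_instance_def)
  have "fully_typed_tgd E \<sigma>" using ft \<sigma> by (simp add: fully_typed_def)
  then have "(\<exists>g zs T. ob = App g (map Var zs) \<and> g \<in> funs E \<and> set zs \<subseteq> tgd_vars \<sigma> \<and>
        To = Shape T \<and> T \<in> types (shex_schema E)) \<or>
     (\<exists>z \<in> tgd_vars \<sigma>. ob = Simple (Var z) \<and> To = LitShape)"
    using form by (rule fully_typed_tgdE)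
  then show ?thesis
  proof (elim disjE exE bexE conjE)
    fix g zs T assume g: "ob = App g (map Var zs)" "To = Shape T" "T \<in> types \<S>"
    have "ShapeAtom (Shape T) (App g (map Var zs)) \<in> set (tgd_head \<sigma>)"
      using form g by (simp add: typed_form_def)
    then have "used_with E g T" "source_term E g (map \<alpha> zs)"
      using \<sigma> source_term_map_Var[OF ok i \<sigma> body] by (auto simp: used_with_def)
    then show ?thesis using g v by (auto simp: comp_def)
  next
    fix z assume "z \<in> tgd_vars \<sigma>" "ob = Simple (Var z)" "To = LitShape"
    then show ?thesis using holds_body_vars[OF ok \<sigma> i body] v by auto
  qed
qed

lemma chase_graphD:
  assumes "(x, p, y) \<in> chase_graph E I"
  shows "x \<in> iris" "p \<in> iris" "y \<in> iris \<or> y \<in> lits"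
proof -
  obtain f vs Ts To where f: "x = F f vs" "fires E I f vs p y Ts To"
    using assms by (auto simp: chase_graph_def)
  show "x \<in> iris" using source_term_iris[OF ok fires_subject(1)[OF f(2)]] f(1) by simp
  show "p \<in> iris" using fires_subject(3)[OF f(2)] .
  show "y \<in> iris \<or> y \<in> lits" using fires_object[OF f(2)] source_term_iris[OF ok] by blast
qed

text \<open>Subjects and constructed objects have the same form, so it does not matter in which of
  the two roles a node received its shape.\<close>

lemma chase_typing_cases:
  assumes "S \<in> chase_typing E I x"
  shows "(\<exists>f vs T. x = F f vs \<and> source_term E f vs \<and> used_with E f T \<and> S = Shape T \<and> T \<in> types \<S>)
    \<or> x \<in> lits \<and> S = LitShape"
proof -
  obtain f vs p v Ts To where fires: "fires E I f vs p v Ts To"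
    and "x = F f vs \<and> S = Shape Ts \<or> x = v \<and> S = To"
    using assms unfolding chase_typing_def by auto
  from this(2) show ?thesis
    using fires_subject(1,2,4)[OF fires] fires_object[OF fires] by (elim disjE conjE) blast+
qed

lemma chase_typing_shape:
  assumes "Shape T \<in> chase_typing E I x"
  obtains f vs where "x = F f vs" "source_term E f vs" "used_with E f T"
  using chase_typing_cases[OF assms] by blast

text \<open>A constructed node determines its constructor, and a constructor is used with a single
  type. Thus only the constraints of one type apply to a chase node.\<close>

lemma chase_typing_unique:
  assumes "Shape T \<in> chase_typing E I x" "Shape T' \<in> chase_typing E I x"
  shows "T = T'"
proof -
  obtain f vs g ws where *: "x = F f vs" "source_term E f vs" "used_with E f T"
    "x = F g ws" "source_term E g ws" "used_with E g T'"
    using assms by (meson chase_typing_shape)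
  then have "f = g" using source_term_inject[OF ok inj] by metis
  then show ?thesis using * ft by (auto simp: fully_typed_def source_term_def)
qed

lemma chase_typing_shapes: "chase_typing E I x \<subseteq> shapes \<S>"
  using chase_typing_cases unfolding shapes_def by blast

lemma blank_notin: "b \<notin> iris" "b \<notin> lits"
  using blank dom_disjoint by blast+

text \<open>Shapes are given only to endpoints of produced triples, which are IRIs or literals. So
  neither the node condition of \<open>shape_fact\<close> nor the override of the typing at
  \<open>b\<close> discards a shape of the chase.\<close>

lemma chase_typing_node:
  assumes "S \<in> chase_typing E I x"
  shows "x \<noteq> b" "\<exists>y p. (x, p, y) \<in> chase_graph E I \<or> (y, p, x) \<in> chase_graph E I"
proof -
  obtain f vs p v Ts To where fires: "fires E I f vs p v Ts To" and x: "x = F f vs \<or> x = v"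
    using assms unfolding chase_typing_def by auto
  have f: "(F f vs, p, v) \<in> chase_graph E I" using fires unfolding chase_graph_def by auto
  with x show "\<exists>y p. (x, p, y) \<in> chase_graph E I \<or> (y, p, x) \<in> chase_graph E I" by auto
  show "x \<noteq> b" using x chase_graphD(1,3)[OF f] blank_notin by auto
qed

section \<open>Facts of the completed graph\<close>

lemma shape_fact_chase:
  assumes "S \<in> chase_typing E I x"
  shows "shape_fact (completion E I b) S x"
  using chase_typing_node[OF assms] assms
  unfolding shape_fact_def nodes_def completion_def by auto

lemma shape_fact_blank:
  assumes "S \<in> shapes \<S>"
  shows "shape_fact (completion E I b) S b"
proof -
  \<comment> \<open>Some IRI must exist for \<open>b\<close> to have a self-loop and hence to be a
    node.\<close>
  have "iris \<noteq> ({} :: 'd set)" using dom_infinite(1) infinite_imp_nonempty by blast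
  then show ?thesis using assms unfolding shape_fact_def nodes_def completion_def by auto
qed

lemma completion_typing:
  assumes "shape_fact (completion E I b) S x" "x \<noteq> b"
  shows "S \<in> chase_typing E I x"
  using assms by (simp add: shape_fact_def completion_def)

text \<open>Chase subjects are IRIs, so every triple leaving \<open>b\<close> is an added one, and
  all added triples end in \<open>b\<close>.\<close>

lemma completion_blank_successor:
  assumes "triple_fact (completion E I b) b p y"
  shows "y = b"
  using assms blank_notin unfolding triple_fact_def completion_def by (auto dest: chase_graphD(1))

lemma completion_tgds:
  assumes "\<sigma> \<in> st_tgds E"
  shows "satisfies_st_tgd I (completion E I b) F \<sigma>"
  unfolding satisfies_st_tgd_def
proof (intro allI impI)
  fix \<alpha> assume body: "holds_body I \<alpha> \<sigma>"
  have "fully_typed_tgd E \<sigma>" using ft assms by (simp add: fully_typed_def)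
  then obtain f ys p ob Ts To where form: "typed_form \<sigma> f ys p ob Ts To"
    unfolding fully_typed_tgd_def by blast
  then have fires: "fires E I f (map \<alpha> ys) p (eval_hterm F \<alpha> ob) Ts To"
    unfolding fires_def using assms body by blast
  then have "triple_fact (completion E I b) (F f (map \<alpha> ys)) p (eval_hterm F \<alpha> ob)"
    unfolding triple_fact_def completion_def chase_graph_def by auto
  moreover have "Shape Ts \<in> chase_typing E I (F f (map \<alpha> ys))"
    "To \<in> chase_typing E I (eval_hterm F \<alpha> ob)"
    using fires unfolding chase_typing_def by blast+
  ultimately show "\<forall>a \<in> set (tgd_head \<sigma>). holds_head_atom (completion E I b) F \<alpha> a"
    using shape_fact_chase by (simp add: typed_form_holds_head[OF form])
qed

section \<open>The shape constraints in the completed graph\<close>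

lemma delta_ok:
  assumes "T \<in> types \<S>" "(p, S, m) \<in> delta \<S> T"
  shows "p \<in> iris" "S \<in> shapes \<S>" "(p, S', m') \<in> delta \<S> T \<Longrightarrow> S' = S \<and> m' = m"
proof -
  have *: "shex_schema_ok \<S>" using ok by (simp add: setting_ok_def)
  show "p \<in> iris" "S \<in> shapes \<S>" using * assms unfolding shex_schema_ok_def by blast+
  show "S' = S \<and> m' = m" if "(p, S', m') \<in> delta \<S> T"
    using * assms that unfolding shex_schema_ok_def by metis
qed

text \<open>The dependency behind the triple asserts its own types \<open>Ts\<close> and
  \<open>To\<close>. Uniqueness of the type of \<open>x\<close> forces \<open>Ts = T\<close>, and
  then having one constraint per predicate forces \<open>To = S\<close>.\<close>

lemma chase_graph_fires:
  assumes "(x, p, y) \<in> chase_graph E I" "Shape T \<in> chase_typing E I x"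
    and "T \<in> types \<S>" "(p, S, m) \<in> delta \<S> T"
  obtains f vs where "x = F f vs" "fires E I f vs p y T S"
proof -
  obtain f vs Ts To where f: "x = F f vs" "fires E I f vs p y Ts To"
    using assms(1) by (auto simp: chase_graph_def)
  then have "Shape Ts \<in> chase_typing E I x" unfolding chase_typing_def by blast
  then have Ts: "Ts = T" using assms(2) by (rule chase_typing_unique)
  obtain m' where "(p, To, m') \<in> delta \<S> T" using fires_subject(5)[OF f(2)] Ts by blast
  then have "To = S" using delta_ok(3)[OF assms(3,4)] by blast
  with f Ts that show thesis by blast
qed

text \<open>Both triples come from the same constructor with the same arguments, so the dependencies
  producing them form a contentious pair whose keys agree, and key coverage equates the
  objects.\<close>

lemma chase_graph_functional:
  assumes kc: "key_covered E"
    and xy: "(x, p, y) \<in> chase_graph E I" and xz: "(x, p, z) \<in> chase_graph E I"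
    and T: "Shape T \<in> chase_typing E I x" "T \<in> types \<S>" "(p, S, m) \<in> delta \<S> T"
      "m \<in> {MultOne, MultOpt}"
  shows "y = z"
proof -
  obtain f vs g ws where fg: "x = F f vs" "fires E I f vs p y T S"
    "x = F g ws" "fires E I g ws p z T S"
    using chase_graph_fires[OF xy T(1-3)] chase_graph_fires[OF xz T(1-3)] by metis
  then have eq: "g = f" "ws = vs"
    using fires_subject(1) source_term_inject[OF ok inj] by metis+
  obtain \<sigma>1 \<alpha>1 ys1 o1 \<sigma>2 \<alpha>2 ys2 o2 where
    \<sigma>: "\<sigma>1 \<in> st_tgds E" "\<sigma>2 \<in> st_tgds E"
    and form: "typed_form \<sigma>1 f ys1 p o1 T S" "typed_form \<sigma>2 f ys2 p o2 T S"
    and body: "holds_body I \<alpha>1 \<sigma>1" "holds_body I \<alpha>2 \<sigma>2"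
    and v: "vs = map \<alpha>1 ys1" "vs = map \<alpha>2 ys2" "y = eval_hterm F \<alpha>1 o1" "z = eval_hterm F \<alpha>2 o2"
    using fg(2,4) unfolding eq fires_def by blast
  have "contentious E \<sigma>1 \<sigma>2" unfolding contentious_def using form T(3,4) by blast
  then have "functionally_overlapping E \<sigma>1 \<sigma>2" using kc \<sigma> by (simp add: key_covered_def)
  then have "map \<alpha>1 ys1 = map \<alpha>2 ys2 \<longrightarrow> eval_hterm F \<alpha>1 o1 = eval_hterm F \<alpha>2 o2"
    unfolding functionally_overlapping_def using form valid body by blast
  then show ?thesis using v by simp
qed

lemma completion_shex:
  assumes kc: "key_covered E"
  shows "satisfies_shex \<S> (completion E I b)"
proof -
  let ?J = "completion E I b"
  have "(\<forall>x y. shape_fact ?J (Shape T) x \<and> triple_fact ?J x p y \<longrightarrow> shape_fact ?J S y) \<and>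
      (m \<in> {MultOne, MultPlus} \<longrightarrow> (\<forall>x. shape_fact ?J (Shape T) x \<longrightarrow> (\<exists>y. triple_fact ?J x p y))) \<and>
      (m \<in> {MultOne, MultOpt} \<longrightarrow>
         (\<forall>x y z. shape_fact ?J (Shape T) x \<and> triple_fact ?J x p y \<and> triple_fact ?J x p z \<longrightarrow> y = z))"
    if T: "T \<in> types \<S>" "(p, S, m) \<in> delta \<S> T" for T p S m
  proof (intro conjI allI impI; (elim conjE)?)
    fix x y assume x: "shape_fact ?J (Shape T) x" and xy: "triple_fact ?J x p y"
    show "shape_fact ?J S y"
    proof (cases "y = b")
      case True
      then show ?thesis using shape_fact_blank delta_ok(2)[OF T] by simp
    next
      case False
      \<comment> \<open>As all edges from \<open>b\<close> return to \<open>b\<close>, an edge with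
        another target comes from the chase, and its dependency already asserts \<open>S\<close> at
        the target.\<close>
      then have "x \<noteq> b" using completion_blank_successor xy by blast
      then have x': "Shape T \<in> chase_typing E I x" using x completion_typing by blast
      have "(x, p, y) \<in> chase_graph E I"
        using xy False by (auto simp: triple_fact_def completion_def)
      then obtain f vs where "fires E I f vs p y T S" using x' T by (rule chase_graph_fires)
      then have "S \<in> chase_typing E I y" unfolding chase_typing_def by blast
      then show ?thesis by (rule shape_fact_chase)
    qed
  next
    fix x assume x: "shape_fact ?J (Shape T) x"
    show "\<exists>y. triple_fact ?J x p y"
    proof (cases "x = b")
      case True
      then show ?thesis using delta_ok(1)[OF T] by (auto simp: triple_fact_def completion_def)
    next
      case False
      then have "Shape T \<in> chase_typing E I x" using x completion_typing by blast
      \<comment> \<open>If the chase offers no \<open>p\<close>-successor, the constraint of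
        \<open>T\<close> on \<open>p\<close> is what triggers the edge to \<open>b\<close>.\<close>
      then show ?thesis using T unfolding triple_fact_def completion_def by auto
    qed
  next
    fix x y z
    assume m: "m \<in> {MultOne, MultOpt}" and x: "shape_fact ?J (Shape T) x"
      and xy: "triple_fact ?J x p y" and xz: "triple_fact ?J x p z"
    show "y = z"
    proof (cases "x = b")
      case True
      then show ?thesis using completion_blank_successor xy xz by blast
    next
      case False
      then have x': "Shape T \<in> chase_typing E I x" using x completion_typing by blast
      \<comment> \<open>An edge from \<open>x\<close> to \<open>b\<close> excludes chase successors
        for the same \<open>p\<close>, so the two targets are both \<open>b\<close> or both from the
        chase.\<close>
      have "y = z \<or> (x, p, y) \<in> chase_graph E I \<and> (x, p, z) \<in> chase_graph E I"
        using xy xz False by (auto simp: triple_fact_def completion_def)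
      then show ?thesis using chase_graph_functional[OF kc _ _ x' T m] by blast
    qed
  qed
  then show ?thesis unfolding satisfies_shex_def by blast
qed

lemma completion_ok: "typed_graph_ok \<S> (completion E I b)"
proof -
  \<comment> \<open>Covers the added edges: their sources carry a type, which in the chase only
    constructed IRIs do.\<close>
  have "x \<in> iris \<and> p \<in> iris"
    if "Shape T \<in> chase_typing E I x" "T \<in> types \<S>" "(p, S, m) \<in> delta \<S> T" for x T p S m
    using chase_typing_shape[OF that(1)] source_term_iris[OF ok] delta_ok(1)[OF that(2,3)] by metis
  then have "graph (completion E I b) \<subseteq> (iris \<union> blanks) \<times> iris \<times> (iris \<union> blanks \<union> lits)"
    using blank unfolding completion_def by (fastforce dest: chase_graphD)
  then show ?thesis
    using chase_typing_shapes unfolding typed_graph_ok_def by (auto simp: completion_def)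
qed

lemma completion_solution: "key_covered E \<Longrightarrow> solution E I (completion E I b)"
  using completion_ok completion_tgds completion_shex by (simp add: solution_def)

end

section \<open>Equivalence of consistency and key coverage\<close>

theorem theorem1:
  fixes E :: "('d::rdf_domain, 'r, 'f, 't) setting"
  assumes "setting_ok E"
    and "injective_constructors E"
    and "fully_typed E"
  shows "consistent E \<longleftrightarrow> key_covered E"
proof
  assume "consistent E"
  with assms(3) show "key_covered E" by (rule consistent_imp_key_covered)
next
  assume kc: "key_covered E"
  \<comment> \<open>One blank node serves all instances, since no chase triple contains a blank
    node.\<close>
  obtain b :: 'd where "b \<in> blanks" using dom_infinite(3) infinite_imp_nonempty by blast
  then have "chase E I b" if "valid_instance (rel_schema E) I" for I
    using assms that by (simp add: chase_def)
  then show "consistent E" unfolding consistent_def using chase.completion_solution kc by blast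
qed

end
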